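(* The constants $k_{2,q,p}$ for $q,p\in\{1,\infty\}$ are $$ k_{2,1,1}=1,\qquad k_{2,1,\infty}=1,\qquad k_{2,\infty,1}=1,\qquad k_{2,\infty,\infty}=\tfrac13 . $$ Moreover, extremal polynomials (i.e. nonzero $P\in\mathcal P(^2\mathbb R^2)$ with $k_{2,q,p}\|P\|_p=|P|_q$) are given by the following list, for every choice of signs: - for $q=p=1$: $\pm x^2$ and $\pm y^2$; - for $q=1$, $p=\infty$: $\pm x^2$ and $\pm y^2$; - for $q=\infty$, $p=1$: $\pm x^2\pm y^2\pm xy$ (independent signs); - for $q=p=\infty$: $\pm(x^2+y^2\pm xy)$ (independent signs).
   Context: $\mathcal P(^2\mathbb R^2)$ is the real vector space of $2$-homogeneous polynomials $P(x,y)=ax^2+bxy+cy^2$ with $a,b,c\in\mathbb R$. For $1\le q<\infty$, $|P|_q=(|a|^q+|b|^q+|c|^q)^{1/q}$, and $|P|_\infty=\max\{|a|,|b|,|c|\}$. For $1\le p\le\infty$, $\|P\|_p=\sup\{|P(x,y)|:\ \|(x,y)\|_{\ell_p^2}\le 1\}$, where $\|(x,y)\|_{\ell_p^2}=(|x|^p+|y|^p)^{1/p}$ for $p<\infty$ and $\max\{|x|,|y|\}$ for $p=\infty$. The constant $k_{2,q,p}$ is the largest $k>0$ such that $k\|P\|_p\le |P|_q$ for all $P\in\mathcal P(^2\mathbb R^2)$. The listed extremal polynomials are not claimed to be exhaustive. *)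

theory Defs
  imports Complex_Main "HOL-Library.Extended_Real"
begin

definition quad_form :: "real \<Rightarrow> real \<Rightarrow> real \<Rightarrow> real \<times> real \<Rightarrow> real" where
  "quad_form a b c = (\<lambda>(x, y). a * x\<^sup>2 + b * x * y + c * y\<^sup>2)"

text \<open>
  A 2-homogeneous polynomial on the real plane is represented by its polynomial function;
  the lemma \<open>coeffs_quad_form\<close> below shows that this function determines the coefficients.
\<close>

definition hom_polys2 :: "(real \<times> real \<Rightarrow> real) set" where
  "hom_polys2 = {P. \<exists>a b c. P = quad_form a b c}"

definition coeffs :: "(real \<times> real \<Rightarrow> real) \<Rightarrow> real \<times> real \<times> real" where
  "coeffs P = (THE (a, b, c). P = quad_form a b c)"

lemma quad_form_eq_iff:
  "quad_form a b c = quad_form a' b' c' \<longleftrightarrow> a = a' \<and> b = b' \<and> c = c'"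
proof
  assume eq: "quad_form a b c = quad_form a' b' c'"
  have "a = a'" "c = c'" "a + b + c = a' + b' + c'"
    using fun_cong[OF eq, of "(1, 0)"] fun_cong[OF eq, of "(0, 1)"] fun_cong[OF eq, of "(1, 1)"]
    by (simp_all add: quad_form_def)
  then show "a = a' \<and> b = b' \<and> c = c'" by simp
qed simp

lemma coeffs_quad_form: "coeffs (quad_form a b c) = (a, b, c)"
  unfolding coeffs_def by (rule the_equality) (auto simp: quad_form_eq_iff)

text \<open>
  Exponents are extended reals, meant to lie between \<open>1\<close> and \<open>\<infinity>\<close>. Since \<open>0 powr r = 0\<close>,
  vanishing entries contribute \<open>0\<close> in the finite case, as they should.
\<close>

definition coeff_norm :: "ereal \<Rightarrow> (real \<times> real \<Rightarrow> real) \<Rightarrow> real" where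
  "coeff_norm q P =
     (case coeffs P of (a, b, c) \<Rightarrow>
        if q = \<infinity> then Max {\<bar>a\<bar>, \<bar>b\<bar>, \<bar>c\<bar>}
        else (\<bar>a\<bar> powr real_of_ereal q + \<bar>b\<bar> powr real_of_ereal q
                + \<bar>c\<bar> powr real_of_ereal q) powr (1 / real_of_ereal q))"

definition lp_norm :: "ereal \<Rightarrow> real \<times> real \<Rightarrow> real" where
  "lp_norm p =
     (\<lambda>(x, y). if p = \<infinity> then max \<bar>x\<bar> \<bar>y\<bar>
        else (\<bar>x\<bar> powr real_of_ereal p + \<bar>y\<bar> powr real_of_ereal p) powr (1 / real_of_ereal p))"

text \<open>
  The supremum is taken in the reals; it is genuine for \<open>P\<close> in \<open>hom_polys2\<close> and \<open>1 \<le> p\<close>,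
  because \<open>P\<close> is then bounded on the unit ball.
\<close>

definition poly_norm :: "ereal \<Rightarrow> (real \<times> real \<Rightarrow> real) \<Rightarrow> real" where
  "poly_norm p P = (SUP z\<in>{z. lp_norm p z \<le> 1}. \<bar>P z\<bar>)"

definition admissible_const :: "ereal \<Rightarrow> ereal \<Rightarrow> real \<Rightarrow> bool" where
  "admissible_const q p k \<longleftrightarrow>
     k > 0 \<and> (\<forall>P\<in>hom_polys2. k * poly_norm p P \<le> coeff_norm q P)"

definition is_largest_const :: "ereal \<Rightarrow> ereal \<Rightarrow> real \<Rightarrow> bool" where
  "is_largest_const q p k \<longleftrightarrow>
     admissible_const q p k \<and> (\<forall>k'. admissible_const q p k' \<longrightarrow> k' \<le> k)"

text \<open>A description; \<open>is_largest_const q p (k2 q p)\<close> expresses that it is well defined.\<close>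

definition k2 :: "ereal \<Rightarrow> ereal \<Rightarrow> real" where
  "k2 q p = (THE k. is_largest_const q p k)"

definition extremal :: "ereal \<Rightarrow> ereal \<Rightarrow> (real \<times> real \<Rightarrow> real) \<Rightarrow> bool" where
  "extremal q p P \<longleftrightarrow>
     P \<in> hom_polys2 \<and> P \<noteq> (\<lambda>_. 0) \<and> k2 q p * poly_norm p P = coeff_norm q P"

end

theory Submission
  imports Defs
begin

text \<open>
  The four constants come from one mechanism. Suppose that \<open>C > 0\<close> and \<open>\<bar>P z\<bar> \<le> C * coeff_norm q P\<close>
  for every form \<open>P\<close> and every \<open>z\<close> in the unit ball, and call a nonzero \<open>P\<close> sharp if equality holds
  at some such \<open>z\<close>.
  A sharp form has \<open>poly_norm p P = C * coeff_norm q P\<close>, so as soon as one exists, no constant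
  larger than \<open>1 / C\<close> is admissible; hence \<open>k2 q p = 1 / C\<close>, and every sharp form is extremal.

  The pointwise bounds are triangle inequalities. If \<open>\<bar>x\<bar>, \<bar>y\<bar> \<le> 1\<close>, all three monomials have
  modulus at most \<open>1\<close>, whence \<open>C = 1\<close> for \<open>q = 1\<close> and \<open>C = 3\<close> for \<open>q = p = \<infinity>\<close>. If
  \<open>\<bar>x\<bar> + \<bar>y\<bar> \<le> 1\<close>, the moduli of the monomials add up to at most \<open>(\<bar>x\<bar> + \<bar>y\<bar>)\<^sup>2 \<le> 1\<close>, whence
  \<open>C = 1\<close> for \<open>q = \<infinity>\<close> and \<open>p = 1\<close>. The listed forms are sharp at \<open>(1, 0)\<close> or \<open>(0, 1)\<close>, except when
  \<open>q = p = \<infinity>\<close>, where the corner \<open>(1, t)\<close> makes all three terms equal to \<open>s\<close>.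
\<close>

definition sup_bound :: "ereal \<Rightarrow> ereal \<Rightarrow> real \<Rightarrow> bool" where
  "sup_bound q p C \<longleftrightarrow>
     (\<forall>P\<in>hom_polys2. \<forall>z. lp_norm p z \<le> 1 \<longrightarrow> \<bar>P z\<bar> \<le> C * coeff_norm q P)"

definition sharp :: "ereal \<Rightarrow> ereal \<Rightarrow> real \<Rightarrow> (real \<times> real \<Rightarrow> real) \<Rightarrow> bool" where
  "sharp q p C P \<longleftrightarrow>
     P \<in> hom_polys2 \<and> coeff_norm q P > 0 \<and>
     (\<exists>z. lp_norm p z \<le> 1 \<and> \<bar>P z\<bar> = C * coeff_norm q P)"

lemma poly_norm_le:
  assumes "sup_bound q p C" "P \<in> hom_polys2"
  shows "poly_norm p P \<le> C * coeff_norm q P"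
proof -
  have "(0, 0) \<in> {z. lp_norm p z \<le> 1}"
    by (simp add: lp_norm_def)
  then show ?thesis
    unfolding poly_norm_def using assms by (intro cSUP_least) (auto simp: sup_bound_def)
qed

lemma poly_norm_sharp:
  assumes bound: "sup_bound q p C" and P: "sharp q p C P"
  shows "poly_norm p P = C * coeff_norm q P"
proof (rule antisym)
  show "poly_norm p P \<le> C * coeff_norm q P"
    using assms by (simp add: poly_norm_le sharp_def)
  obtain z where z: "lp_norm p z \<le> 1" "\<bar>P z\<bar> = C * coeff_norm q P"
    using P by (auto simp: sharp_def)
  \<comment> \<open>Real suprema only dominate their members when the set is bounded, which the bound supplies.\<close>
  have "bdd_above ((\<lambda>z. \<bar>P z\<bar>) ` {z. lp_norm p z \<le> 1})"
    using assms by (intro bdd_aboveI2[where M = "C * coeff_norm q P"])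
      (auto simp: sup_bound_def sharp_def)
  then have "\<bar>P z\<bar> \<le> poly_norm p P"
    unfolding poly_norm_def using z by (intro cSUP_upper) auto
  then show "C * coeff_norm q P \<le> poly_norm p P"
    using z by simp
qed

text \<open>
  A competitor \<open>k'\<close>, tested on a sharp form, satisfies
  \<open>k' * (C * coeff_norm q P) \<le> coeff_norm q P\<close>, and the positive factor cancels.
\<close>

lemma is_largest_const_sharp:
  assumes C: "C > 0" and bound: "sup_bound q p C" and P: "sharp q p C P"
  shows "is_largest_const q p (1 / C)"
  unfolding is_largest_const_def
proof (intro conjI allI impI)
  show "admissible_const q p (1 / C)"
    using C poly_norm_le[OF bound] by (auto simp: admissible_const_def field_simps)
  fix k' assume "admissible_const q p k'"
  then have "k' * (C * coeff_norm q P) \<le> coeff_norm q P"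
    using P poly_norm_sharp[OF bound P] by (auto simp: admissible_const_def sharp_def)
  then have "(k' * C) * coeff_norm q P \<le> 1 * coeff_norm q P"
    by (simp add: mult.assoc)
  then have "k' * C \<le> 1"
    using P by (simp add: sharp_def)
  then show "k' \<le> 1 / C"
    using C by (simp add: field_simps)
qed

lemma k2_eqI:
  assumes "is_largest_const q p k"
  shows "k2 q p = k"
  unfolding k2_def using assms by (intro the_equality) (auto simp: is_largest_const_def intro: antisym)

lemma extremal_sharp:
  assumes C: "C > 0" and bound: "sup_bound q p C" and P: "sharp q p C P"
  shows "extremal q p P"
proof -
  have "k2 q p = 1 / C"
    by (rule k2_eqI[OF is_largest_const_sharp[OF assms]])
  moreover have "P \<noteq> (\<lambda>_. 0)"
    using C P by (auto simp: sharp_def)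
  ultimately show ?thesis
    using C P poly_norm_sharp[OF bound P] by (simp add: extremal_def sharp_def)
qed

lemma lp_norm_one: "lp_norm 1 (x, y) = \<bar>x\<bar> + \<bar>y\<bar>"
  by (simp add: lp_norm_def)

lemma lp_norm_infinity: "lp_norm \<infinity> (x, y) = max \<bar>x\<bar> \<bar>y\<bar>"
  by (simp add: lp_norm_def)

lemma coeff_norm_one: "coeff_norm 1 (quad_form a b c) = \<bar>a\<bar> + \<bar>b\<bar> + \<bar>c\<bar>"
  by (simp add: coeff_norm_def coeffs_quad_form)

lemma coeff_norm_infinity: "coeff_norm \<infinity> (quad_form a b c) = max \<bar>a\<bar> (max \<bar>b\<bar> \<bar>c\<bar>)"
  by (simp add: coeff_norm_def coeffs_quad_form)

lemma abs_quad_form_le: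
  "\<bar>quad_form a b c (x, y)\<bar> \<le> \<bar>a\<bar> * \<bar>x\<bar>\<^sup>2 + \<bar>b\<bar> * (\<bar>x\<bar> * \<bar>y\<bar>) + \<bar>c\<bar> * \<bar>y\<bar>\<^sup>2"
proof -
  have "\<bar>quad_form a b c (x, y)\<bar> \<le> \<bar>a * x\<^sup>2\<bar> + \<bar>b * x * y\<bar> + \<bar>c * y\<^sup>2\<bar>"
    unfolding quad_form_def by simp
  then show ?thesis
    by (simp add: abs_mult mult.assoc)
qed

lemma abs_quad_form_le_square:
  assumes "\<bar>x\<bar> \<le> 1" "\<bar>y\<bar> \<le> 1"
  shows "\<bar>quad_form a b c (x, y)\<bar> \<le> \<bar>a\<bar> + \<bar>b\<bar> + \<bar>c\<bar>"
proof -
  have "\<bar>x\<bar>\<^sup>2 \<le> 1" "\<bar>x\<bar> * \<bar>y\<bar> \<le> 1" "\<bar>y\<bar>\<^sup>2 \<le> 1"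
    using assms by (simp_all add: abs_square_le_1 mult_le_one)
  then have "\<bar>a\<bar> * \<bar>x\<bar>\<^sup>2 + \<bar>b\<bar> * (\<bar>x\<bar> * \<bar>y\<bar>) + \<bar>c\<bar> * \<bar>y\<bar>\<^sup>2 \<le> \<bar>a\<bar> * 1 + \<bar>b\<bar> * 1 + \<bar>c\<bar> * 1"
    by (intro add_mono mult_left_mono) auto
  then show ?thesis
    using abs_quad_form_le[of a b c x y] by simp
qed

lemma abs_quad_form_le_diamond:
  assumes "\<bar>x\<bar> + \<bar>y\<bar> \<le> 1"
  shows "\<bar>quad_form a b c (x, y)\<bar> \<le> max \<bar>a\<bar> (max \<bar>b\<bar> \<bar>c\<bar>)"
proof -
  define M where "M = max \<bar>a\<bar> (max \<bar>b\<bar> \<bar>c\<bar>)"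
  have "\<bar>quad_form a b c (x, y)\<bar> \<le> \<bar>a\<bar> * \<bar>x\<bar>\<^sup>2 + \<bar>b\<bar> * (\<bar>x\<bar> * \<bar>y\<bar>) + \<bar>c\<bar> * \<bar>y\<bar>\<^sup>2"
    by (rule abs_quad_form_le)
  also have "\<dots> \<le> M * \<bar>x\<bar>\<^sup>2 + M * (\<bar>x\<bar> * \<bar>y\<bar>) + M * \<bar>y\<bar>\<^sup>2"
    unfolding M_def by (intro add_mono mult_right_mono) auto
  also have "\<dots> = M * (\<bar>x\<bar>\<^sup>2 + \<bar>x\<bar> * \<bar>y\<bar> + \<bar>y\<bar>\<^sup>2)"
    by (simp add: distrib_left)
  also have "\<dots> \<le> M * (\<bar>x\<bar> + \<bar>y\<bar>)\<^sup>2"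
    unfolding M_def by (intro mult_left_mono) (auto simp: power2_sum)
  also have "\<dots> \<le> M * 1"
    using assms unfolding M_def by (intro mult_left_mono power_le_one) auto
  finally show ?thesis
    by (simp add: M_def)
qed

lemma sup_bound_one_one: "sup_bound 1 1 1"
proof -
  have "\<bar>quad_form a b c (x, y)\<bar> \<le> \<bar>a\<bar> + \<bar>b\<bar> + \<bar>c\<bar>" if "\<bar>x\<bar> + \<bar>y\<bar> \<le> 1" for a b c x y
    using that by (intro abs_quad_form_le_square) auto
  then show ?thesis
    by (auto simp: sup_bound_def hom_polys2_def lp_norm_one coeff_norm_one)
qed

lemma sup_bound_one_infinity: "sup_bound 1 \<infinity> 1"
  by (auto simp: sup_bound_def hom_polys2_def lp_norm_infinity coeff_norm_one
      intro!: abs_quad_form_le_square)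

lemma sup_bound_infinity_one: "sup_bound \<infinity> 1 1"
  by (auto simp: sup_bound_def hom_polys2_def lp_norm_one coeff_norm_infinity
      simp del: max.bounded_iff intro!: abs_quad_form_le_diamond)

lemma sup_bound_infinity_infinity: "sup_bound \<infinity> \<infinity> 3"
proof -
  have "\<bar>quad_form a b c (x, y)\<bar> \<le> 3 * max \<bar>a\<bar> (max \<bar>b\<bar> \<bar>c\<bar>)"
    if "\<bar>x\<bar> \<le> 1" "\<bar>y\<bar> \<le> 1" for a b c x y
    using abs_quad_form_le_square[OF that, of a b c] by linarith
  then show ?thesis
    by (auto simp: sup_bound_def hom_polys2_def lp_norm_infinity coeff_norm_infinity)
qed

lemma sharp_quad_formI:
  assumes "P = quad_form a b c" "coeff_norm q (quad_form a b c) > 0" "lp_norm p z \<le> 1"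
    "\<bar>quad_form a b c z\<bar> = C * coeff_norm q (quad_form a b c)"
  shows "sharp q p C P"
  unfolding sharp_def hom_polys2_def using assms by blast

lemma sharp_one_x_squared:
  assumes "s \<in> {1, -1}" "p \<in> {1, \<infinity>}"
  shows "sharp 1 p 1 (\<lambda>(x, y). s * x\<^sup>2)"
  using assms
  by (intro sharp_quad_formI[where a = s and b = 0 and c = 0 and z = "(1, 0)"])
    (auto simp: coeff_norm_one lp_norm_one lp_norm_infinity, auto simp: quad_form_def)

lemma sharp_one_y_squared:
  assumes "s \<in> {1, -1}" "p \<in> {1, \<infinity>}"
  shows "sharp 1 p 1 (\<lambda>(x, y). s * y\<^sup>2)"
  using assms
  by (intro sharp_quad_formI[where a = 0 and b = 0 and c = s and z = "(0, 1)"])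
    (auto simp: coeff_norm_one lp_norm_one lp_norm_infinity, auto simp: quad_form_def)

lemma sharp_infinity_one:
  assumes "s \<in> {1, -1}" "t \<in> {1, -1}" "u \<in> {1, -1}"
  shows "sharp \<infinity> 1 1 (\<lambda>(x, y). s * x\<^sup>2 + t * y\<^sup>2 + u * (x * y))"
  using assms
  by (intro sharp_quad_formI[where a = s and b = u and c = t and z = "(1, 0)"])
    (auto simp: coeff_norm_infinity lp_norm_one, auto simp: quad_form_def)

lemma sharp_infinity_infinity:
  assumes "s \<in> {1, -1}" "t \<in> {1, -1}"
  shows "sharp \<infinity> \<infinity> 3 (\<lambda>(x, y). s * (x\<^sup>2 + y\<^sup>2 + t * (x * y)))"
  using assms
  by (intro sharp_quad_formI[where a = s and b = "s * t" and c = s and z = "(1, t)"])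
    (auto simp: coeff_norm_infinity lp_norm_infinity, auto simp: quad_form_def algebra_simps)

theorem theorem2p3:
  shows "(\<forall>q\<in>{1, \<infinity>}. \<forall>p\<in>{1, \<infinity>}. is_largest_const q p (k2 q p))
    \<and> k2 1 1 = 1 \<and> k2 1 \<infinity> = 1 \<and> k2 \<infinity> 1 = 1 \<and> k2 \<infinity> \<infinity> = 1 / 3
    \<and> (\<forall>s\<in>{1, -1}. extremal 1 1 (\<lambda>(x, y). s * x\<^sup>2) \<and> extremal 1 1 (\<lambda>(x, y). s * y\<^sup>2))
    \<and> (\<forall>s\<in>{1, -1}. extremal 1 \<infinity> (\<lambda>(x, y). s * x\<^sup>2) \<and> extremal 1 \<infinity> (\<lambda>(x, y). s * y\<^sup>2))
    \<and> (\<forall>s\<in>{1, -1}. \<forall>t\<in>{1, -1}. \<forall>u\<in>{1, -1}.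
          extremal \<infinity> 1 (\<lambda>(x, y). s * x\<^sup>2 + t * y\<^sup>2 + u * (x * y)))
    \<and> (\<forall>s\<in>{1, -1}. \<forall>t\<in>{1, -1}.
          extremal \<infinity> \<infinity> (\<lambda>(x, y). s * (x\<^sup>2 + y\<^sup>2 + t * (x * y))))"
proof -
  have L: "is_largest_const 1 1 1" "is_largest_const 1 \<infinity> 1"
      "is_largest_const \<infinity> 1 1" "is_largest_const \<infinity> \<infinity> (1 / 3)"
    using is_largest_const_sharp[OF _ sup_bound_one_one sharp_one_x_squared[of 1]]
      is_largest_const_sharp[OF _ sup_bound_one_infinity sharp_one_x_squared[of 1]]
      is_largest_const_sharp[OF _ sup_bound_infinity_one sharp_infinity_one[of 1 1 1]]
      is_largest_const_sharp[OF _ sup_bound_infinity_infinity sharp_infinity_infinity[of 1 1]]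
    by simp_all
  note K = L[THEN k2_eqI]
  have largest: "\<forall>q\<in>{1, \<infinity>}. \<forall>p\<in>{1, \<infinity>}. is_largest_const q p (k2 q p)"
    using L by (simp add: K del: divide_eq_eq)
  show ?thesis
    by (intro conjI ballI largest K
        extremal_sharp[OF _ sup_bound_one_one] extremal_sharp[OF _ sup_bound_one_infinity]
        extremal_sharp[OF _ sup_bound_infinity_one] extremal_sharp[OF _ sup_bound_infinity_infinity]
        sharp_one_x_squared sharp_one_y_squared sharp_infinity_one sharp_infinity_infinity)
      simp_all
qed

end
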